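(* For every integer $k\ge 3$, there exists a $6$-regular minimally $\frac{2k}{k-1}$-tough graph of order $3k+1$.
   Context: All graphs are finite and simple. The order of a graph is its number of vertices. A graph is $r$-regular if every vertex has degree $r$. For a graph $G$, let $c(G)$ denote the number of connected components of $G$. For a nonnegative real number $t$, a graph $G$ is said to be $t$-tough if $t\cdot c(G-X)\le |X|$ for all $X\subseteq V(G)$ with $c(G-X)>1$, where $G-X$ is the graph obtained from $G$ by deleting the vertices in $X$. The toughness $\tau(G)$ of $G$ is the maximum value of $t$ such that $G$ is $t$-tough, with the convention $\tau(K_n)=\infty$ for all $n\ge 1$, where $K_n$ is the complete graph of order $n$. A graph $G$ is said to be minimally $t$-tough if $\tau(G)=t$ and $\tau(G-e)<t$ for every edge $e\in E(G)$, where $G-e$ is the graph obtained from $G$ by deleting the edge $e$ (keeping all vertices). *)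

theory Defs
  imports "Graph_Theory.Graph_Theory" "HOL-Library.Extended_Real"
begin

text \<open>
  A finite simple graph is a \<^locale>\<open>pair_graph\<close>, i.e. a finite, loop-free, symmetric digraph
  without parallel arcs; the undirected edge \<open>uv\<close> is the pair of arcs \<open>(u,v)\<close>, \<open>(v,u)\<close>.
\<close>

definition regular :: "nat \<Rightarrow> 'a pair_pre_digraph \<Rightarrow> bool" where
  "regular r G \<longleftrightarrow> (\<forall>v \<in> pverts G. out_degree (with_proj G) v = r)"

text \<open>
  The name is qualified because \<open>connected\<close> also denotes connectedness of topological spaces.
  The null graph is not connected, so it has no components.
\<close>

definition num_components :: "('a, 'b) pre_digraph \<Rightarrow> nat" where
  "num_components G = card {H. pre_digraph.max_subgraph G Digraph_Component.connected H}"

definition tough :: "real \<Rightarrow> 'a pair_pre_digraph \<Rightarrow> bool" where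
  "tough t G \<longleftrightarrow> (\<forall>X \<subseteq> pverts G.
     let c = num_components (with_proj G \<restriction> (pverts G - X))
     in c > 1 \<longrightarrow> t * real c \<le> real (card X))"

text \<open>
  The maximum exists for every finite simple graph that is not complete, see
  \<open>toughness_attained\<close> below; the null graph is not assigned a meaningful value.
\<close>

definition toughness :: "'a pair_pre_digraph \<Rightarrow> ereal" where
  "toughness G =
     (if \<exists>n\<ge>1. K\<^bsub>n\<^esub> (with_proj G) then \<infinity> else ereal (GREATEST t. 0 \<le> t \<and> tough t G))"

definition del_edge :: "'a pair_pre_digraph \<Rightarrow> 'a \<times> 'a \<Rightarrow> 'a pair_pre_digraph" where
  "del_edge G e = G\<lparr>parcs := parcs G - {e, (snd e, fst e)}\<rparr>"

definition minimally_tough :: "real \<Rightarrow> 'a pair_pre_digraph \<Rightarrow> bool" where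
  "minimally_tough t G \<longleftrightarrow>
     toughness G = ereal t \<and> (\<forall>e \<in> parcs G. toughness (del_edge G e) < ereal t)"

lemma (in sym_digraph) num_components_eq: "num_components G = card sccs_verts"
proof -
  have mono: "arc_mono (Digraph_Component.connected :: ('a, 'b) pre_digraph \<Rightarrow> bool)"
    unfolding arc_mono_def
  proof (intro allI impI)
    fix H1 H2 :: "('a, 'b) pre_digraph"
    assume A: "Digraph_Component.connected H1 \<and> subgraph H1 H2 \<and> verts H1 = verts H2"
    then interpret H2: wf_digraph H2 by (simp add: subgraph_def)
    show "Digraph_Component.connected H2"
      using A by (intro H2.connected_spanning_imp_connected[of H1]) (auto simp: spanning_def)
  qed
  have sc: "strongly_connected H"
    if "induced_subgraph H G" "Digraph_Component.connected H" for H
  proof -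
    interpret H: wf_digraph H using that(1) by (rule wf_digraphI_induced)
    show ?thesis
      using H.symmetric_connected_imp_strongly_connected that
        induced_graph_imp_symmetric[OF sym_arcs that(1)] by blast
  qed
  have conn: "Digraph_Component.connected H" if "subgraph H G" "strongly_connected H" for H
  proof -
    interpret H: wf_digraph H using that(1) by (simp add: subgraph_def)
    show ?thesis
      using that(2) by (auto simp: strongly_connected_def
        intro!: H.connectedI H.reachable_mk_symmetricI)
  qed
  have "max_subgraph Digraph_Component.connected H \<longleftrightarrow> max_subgraph strongly_connected H" for H
  proof
    assume H: "max_subgraph Digraph_Component.connected H"
    then have "induced_subgraph H G" by (rule induced_subgraphI_arc_mono[OF _ mono])
    then have "strongly_connected H" using sc H max_subgraph_prop by blast
    then show "max_subgraph strongly_connected H"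
      using H conn unfolding max_subgraph_def by blast
  next
    assume H: "max_subgraph strongly_connected H"
    show "max_subgraph Digraph_Component.connected H"
    proof (rule max_subgraphI)
      show "Digraph_Component.connected H" "subgraph H G"
        using H conn unfolding max_subgraph_def by blast+
    next
      fix y assume y: "H \<noteq> y" "subgraph H y" "subgraph y G"
      show "\<not> Digraph_Component.connected y"
      proof
        assume c: "Digraph_Component.connected y"
        let ?y = "G \<restriction> verts y"
        have ind: "induced_subgraph ?y G" using y(3) by (auto simp: subgraph_def)
        have yy: "subgraph y ?y" using y(3) by (simp add: subgraph_induce_subgraphI2)
        have "Digraph_Component.connected ?y"
          using mono c yy unfolding arc_mono_def by (metis induce_subgraph_verts)
        then have "strongly_connected ?y" using ind sc by blast
        moreover have "subgraph H ?y" using y(2) yy subgraph_trans by blast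
        ultimately have "H = ?y"
          using H ind induced_imp_subgraph unfolding max_subgraph_def by metis
        then show False
          using y yy by (auto simp: subgraph_def compatible_def intro: pre_digraph.equality)
      qed
    qed
  qed
  then have "{H. max_subgraph Digraph_Component.connected H} = {H. max_subgraph strongly_connected H}"
    by blast
  then show ?thesis
    unfolding num_components_def card_sccs_verts sccs_altdef2 by (rule arg_cong)
qed

lemma toughness_attained:
  assumes "pair_graph G" "pverts G \<noteq> {}" "\<not> (\<exists>n\<ge>1. K\<^bsub>n\<^esub> (with_proj G))"
  obtains t where "toughness G = ereal t" "0 \<le> t" "tough t G"
    "\<And>s. 0 \<le> s \<Longrightarrow> tough s G \<Longrightarrow> s \<le> t"
proof -
  interpret pair_graph G by fact
  let ?c = "\<lambda>X. num_components (with_proj G \<restriction> (pverts G - X))"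
  define A where "A = {X. X \<subseteq> pverts G \<and> ?c X > 1}"
  have fin: "finite A" unfolding A_def using pair_finite_verts by auto
  have "card (pverts G) \<ge> 1"
    using assms(2) pair_finite_verts by (simp add: Suc_le_eq card_gt_0_iff)
  then have "parcs G \<noteq> {(u,v). (u,v) \<in> pverts G \<times> pverts G \<and> u \<noteq> v}"
    using assms(3) pair_finite_verts unfolding complete_digraph_pair_def by blast
  moreover have "parcs G \<subseteq> {(u,v). (u,v) \<in> pverts G \<times> pverts G \<and> u \<noteq> v}"
    by (auto dest: in_arcsD1 in_arcsD2 no_loops')
  ultimately obtain u v
    where uv: "u \<in> pverts G" "v \<in> pverts G" "u \<noteq> v" "(u,v) \<notin> parcs G"
    by blast
  then have vu: "(v,u) \<notin> parcs G" using arcs_symmetric by blast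
  let ?H = "with_proj G \<restriction> {u,v}"
  have arcsH: "arcs_ends ?H = {}" "verts ?H = {u,v}"
    using uv vu no_loops' by (auto simp: arcs_ends_def arc_to_ends_def)
  have reach: "a \<rightarrow>\<^sup>*\<^bsub>?H\<^esub> b \<longleftrightarrow> a = b \<and> a \<in> {u,v}" for a b
  proof
    assume "a \<rightarrow>\<^sup>*\<^bsub>?H\<^esub> b"
    then have "(a,b) \<in> rtrancl_on {u,v} {}" unfolding reachable_def arcsH .
    then show "a = b \<and> a \<in> {u,v}" by (induct rule: rtrancl_on.induct) auto
  qed (auto simp: reachable_def arcsH)
  interpret H: sym_digraph ?H
    by unfold_locales (use uv vu no_loops' in \<open>auto simp: symmetric_def arcsH\<close>)
  have "H.sccs_verts = {{u},{v}}"
    unfolding H.in_sccs_verts_conv_reachable reach set_eq_iff by auto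
  then have "num_components ?H = 2" using uv(3) by (simp add: H.num_components_eq)
  moreover have "pverts G - (pverts G - {u,v}) = {u,v}" using uv by auto
  ultimately have "pverts G - {u,v} \<in> A" unfolding A_def by auto
  then have ne: "A \<noteq> {}" by auto
  define t where "t = Min ((\<lambda>X. real (card X) / real (?c X)) ` A)"
  have iff: "tough s G \<longleftrightarrow> s \<le> t" for s
  proof -
    have "tough s G \<longleftrightarrow> (\<forall>X\<in>A. s \<le> real (card X) / real (?c X))"
      unfolding tough_def A_def Let_def by (auto simp: field_simps)
    also have "\<dots> \<longleftrightarrow> s \<le> t" unfolding t_def using fin ne by (subst Min_ge_iff) auto
    finally show ?thesis .
  qed
  have t0: "0 \<le> t" unfolding t_def using fin ne by (subst Min_ge_iff) auto
  have "(GREATEST t. 0 \<le> t \<and> tough t G) = t"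
    by (rule Greatest_equality) (auto simp: iff t0)
  then have "toughness G = ereal t" using assms(3) by (simp add: toughness_def)
  then show ?thesis using that t0 iff by simp
qed

end

(*
  The graph is the circulant C_n(1,2,4) on n = 3k+1 vertices.

  Lower bound: let S be what remains after deleting X, with c >= 2 components. From each
  component pick a vertex d that is the end of a block, i.e. the next remaining vertex on the
  cycle lies in another component. The jumps 1 and 2 force d+1 and d+2 to be deleted, so
  |X| >= 2c. If at most one further vertex were deleted, the jump 4 would leave room for at most
  one vertex of S besides the picked ones; so n would be 3c, 3c+1 or 3c+2, where only 3c+1 is
  compatible with n = 3k+1, and there the jump 4 joins two components. Hence |X| >= 2c+2, and
  then c <= k-1 because X and S fit into 3k+1 vertices.

  Equality and minimality are witnessed by explicit remaining sets, given as offsets from an end of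
  the deleted edge: mostly isolated vertices at distance 3, with few irregular ones near the edge.
*)

theory Submission
  imports Defs
begin

section \<open>Rotations of the cycle of residues modulo \<open>n\<close>\<close>

definition rot :: "nat \<Rightarrow> int \<Rightarrow> nat \<Rightarrow> nat" where
  "rot n i x = nat ((int x + i) mod int n)"

context
  fixes n :: nat
  assumes n_pos: "0 < n"
begin

lemma rot_less: "rot n i x < n"
  using n_pos by (simp add: rot_def nat_less_iff)

lemma int_rot: "int (rot n i x) = (int x + i) mod int n"
  using n_pos by (simp add: rot_def)

lemma rot_rot: "rot n i (rot n j x) = rot n (j + i) x"
  using int_rot[of j x] by (simp add: rot_def mod_simps add.assoc)

lemma rot_0: "x < n \<Longrightarrow> rot n 0 x = x"
  by (simp add: rot_def)

lemma rot_eq_iff: "rot n i x = rot n j x \<longleftrightarrow> int n dvd i - j"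
proof -
  have "rot n i x = rot n j x \<longleftrightarrow> int (rot n i x) = int (rot n j x)"
    by simp
  also have "\<dots> \<longleftrightarrow> int n dvd i - j"
    unfolding int_rot by (simp add: mod_eq_dvd_iff)
  finally show ?thesis .
qed

lemma rot_inject: "x < n \<Longrightarrow> y < n \<Longrightarrow> rot n i x = rot n i y \<Longrightarrow> x = y"
  by (metis add.right_inverse rot_0 rot_rot)

lemma ex_rot:
  assumes "x < n" "y < n"
  shows "\<exists>m<n. y = rot n (int m) x"
proof (intro exI conjI)
  show "nat ((int y - int x) mod int n) < n"
    using n_pos by (simp add: nat_less_iff)
  show "y = rot n (int (nat ((int y - int x) mod int n))) x"
    using assms by (simp add: rot_def mod_simps)
qed

lemma rot_closed_eq:
  assumes "T \<subseteq> {..<n}" "T \<noteq> {}" and closed: "\<And>x. x \<in> T \<Longrightarrow> rot n 1 x \<in> T"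
  shows "T = {..<n}"
proof -
  obtain x where x: "x \<in> T" "x < n" using assms by auto
  have "rot n (int m) x \<in> T" for m
  proof (induction m)
    case 0
    then show ?case using x by (simp add: rot_0)
  next
    case (Suc m)
    then show ?case using closed[OF Suc] by (simp add: rot_rot add.commute)
  qed
  then show ?thesis using ex_rot[OF x(2)] assms(1) by auto
qed

section \<open>Lower bound for the size of a separator\<close>

text \<open>Walk from \<open>s\<close> by unit steps to the first remaining vertex with another
  label; \<open>d\<close> is the last remaining vertex before it. Jumps 1 and 2 keep the label, so
  at least two positions after \<open>d\<close> are deleted. The third is either still in the gap or
  the vertex with the other label.\<close>

lemma ex_boundary:
  assumes S: "S \<subseteq> {..<n}"
    and f: "\<And>x j. x \<in> S \<Longrightarrow> j \<in> {1, 2} \<Longrightarrow> rot n j x \<in> S \<Longrightarrow> f (rot n j x) = f x"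
    and "s \<in> S" "t \<in> S" "f t \<noteq> f s"
  shows "\<exists>d\<in>S. f d = f s \<and> rot n 1 d \<notin> S \<and> rot n 2 d \<notin> S
    \<and> (rot n 3 d \<in> S \<longrightarrow> f (rot n 3 d) \<noteq> f s)"
proof -
  let ?P = "\<lambda>m::nat. rot n (int m) s \<in> S \<and> f (rot n (int m) s) \<noteq> f s"
  define m where "m = (LEAST m. ?P m)"
  have "\<exists>m. ?P m" using ex_rot[of s t] assms by auto
  then have m: "?P m" unfolding m_def by (rule LeastI_ex)
  have less_m: "\<not> ?P i" if "i < m" for i using that unfolding m_def by (rule not_less_Least)
  have s0: "rot n 0 s = s" using assms by (auto intro: rot_0)
  then have "m \<noteq> 0" using m by (auto intro: ccontr)
  define I where "I = {i. i < m \<and> rot n (int i) s \<in> S}"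
  define i where "i = Max I"
  have I: "finite I" "0 \<in> I" unfolding I_def using \<open>m \<noteq> 0\<close> s0 \<open>s \<in> S\<close> by auto
  have "i \<in> I" unfolding i_def using I by (intro Max_in) auto
  then have i: "i < m" "rot n (int i) s \<in> S" unfolding I_def by auto
  have gap: "rot n (int j) s \<notin> S" if "i < j" "j < m" for j
    using that Max_ge[of I j] I unfolding i_def[symmetric] by (auto simp: I_def)
  define d where "d = rot n (int i) s"
  have fd: "f d = f s" "d \<in> S" using less_m[OF i(1)] i(2) by (auto simp: d_def)
  have rd: "rot n (int j) d = rot n (int (i + j)) s" for j by (simp add: d_def rot_rot)
  have "m \<noteq> i + 1" "m \<noteq> i + 2"
    using m f[of d 1] f[of d 2] fd rd[of 1] rd[of 2] by auto
  then have "i + 3 \<le> m" using i by linarith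
  then have "rot n 1 d \<notin> S" "rot n 2 d \<notin> S" "rot n 3 d \<in> S \<longrightarrow> f (rot n 3 d) \<noteq> f s"
    using gap[of "i + 1"] gap[of "i + 2"] gap[of "i + 3"] m rd[of 1] rd[of 2] rd[of 3]
    by (cases "m = i + 3"; auto)+
  then show ?thesis using fd by blast
qed

text \<open>A labelling constant along edges stands for the components, which leaves only arithmetic
  on the cycle. With at most one deletion beyond twice the number of labels, the remaining set is
  one block end per label and at most one more vertex; counting modulo 3 or the jump 4 refutes
  this.\<close>

lemma card_separator_ge:
  fixes f :: "nat \<Rightarrow> 'b"
  assumes n3: "n mod 3 = 1" and S: "S \<subseteq> {..<n}"
    and f: "\<And>x j. x \<in> S \<Longrightarrow> j \<in> {1, 2, 4} \<Longrightarrow> rot n j x \<in> S \<Longrightarrow> f (rot n j x) = f x"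
    and c2: "2 \<le> card (f ` S)"
  shows "2 * card (f ` S) + 2 \<le> card ({..<n} - S)"
proof (rule ccontr)
  assume "\<not> ?thesis"
  then have small: "card ({..<n} - S) \<le> 2 * card (f ` S) + 1" by simp
  have finS: "finite S" using S finite_subset by blast
  let ?c = "card (f ` S)"
  let ?good = "\<lambda>C d. d \<in> S \<and> f d = C \<and> rot n 1 d \<notin> S \<and> rot n 2 d \<notin> S
    \<and> (rot n 3 d \<in> S \<longrightarrow> f (rot n 3 d) \<noteq> C)"
  have "\<exists>d. ?good C d" if "C \<in> f ` S" for C
  proof -
    obtain s where s: "s \<in> S" "C = f s" using \<open>C \<in> f ` S\<close> by auto
    have "f ` S \<noteq> {C}" using c2 by auto
    then obtain t where "t \<in> S" "f t \<noteq> f s" using s by auto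
    then show ?thesis using ex_boundary[OF S f s(1)] s by auto
  qed
  then obtain g where g: "\<And>C. C \<in> f ` S \<Longrightarrow> ?good C (g C)" by metis
  \<comment> \<open>One block end per label. The two successors of each are deleted, and all these
    successors are distinct, which gives the main term \<open>2 * ?c\<close>.\<close>
  define D where "D = g ` f ` S"
  have DS: "D \<subseteq> S" using g by (auto simp: D_def)
  have finD: "finite D" using DS finS finite_subset by blast
  have injf: "inj_on f D" using g by (auto simp: D_def inj_on_def)
  have "inj_on g (f ` S)" using g by (metis inj_onI)
  then have cardD: "card D = ?c" by (simp add: D_def card_image)
  have D1: "rot n 1 d \<notin> S" "rot n 2 d \<notin> S" "rot n 3 d \<in> S \<Longrightarrow> f (rot n 3 d) \<noteq> f d"
    if "d \<in> D" for d using that g by (auto simp: D_def)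
  have lt: "x < n" if "x \<in> S" for x using that S by auto
  let ?A = "rot n 1 ` D" and ?B = "rot n 2 ` D"
  have inj: "inj_on (rot n i) D" for i
    by (rule inj_onI) (meson DS lt rot_inject subsetD)
  have "?A \<inter> ?B = {}"
  proof -
    have False if "d \<in> D" "e \<in> D" "rot n 1 d = rot n 2 e" for d e
    proof -
      have "rot n 1 d = rot n 1 (rot n 1 e)" using that by (simp add: rot_rot)
      then have "d = rot n 1 e" using that DS lt rot_less by (metis rot_inject subsetD)
      then show False using that D1 DS by auto
    qed
    then show ?thesis by blast
  qed
  then have cardAB: "card (?A \<union> ?B) = 2 * ?c"
    using finD cardD inj by (simp add: card_Un_disjoint card_image)
  \<comment> \<open>The excess over the bound 2c; it has at most one element, which is refuted below.\<close>
  define Z where "Z = {..<n} - S - (?A \<union> ?B)"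
  have AB: "?A \<union> ?B \<subseteq> {..<n} - S" using D1 rot_less by auto
  have X: "card ({..<n} - S) = 2 * ?c + card Z"
    unfolding Z_def using AB cardAB finD
    by (metis card_Diff_subset card_mono finite_Diff finite_UnI finite_imageI finite_lessThan
        le_add_diff_inverse)
  then have Z1: "card Z \<le> 1" using small by simp
  have finZ: "finite Z" by (simp add: Z_def)
  have n_eq: "n = card S + 2 * ?c + card Z"
    using X S finS card_mono[of "{..<n}" S] by (simp add: card_Diff_subset)
  have Z_eq: "x = y" if "x \<in> Z" "y \<in> Z" for x y
    using Z1 finZ that by (auto simp: card_le_Suc0_iff_eq)
  have cases: "x \<in> S \<or> x \<in> Z \<or> rot n (-1) x \<in> D \<or> rot n (-2) x \<in> D" if "x < n" for x
  proof -
    have "rot n (-1) (rot n 1 d) = d" "rot n (-2) (rot n 2 d) = d" if "d \<in> D" for d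
      using that DS lt by (auto simp: rot_rot rot_0)
    then show ?thesis using that unfolding Z_def by auto
  qed
  have d3: "rot n 3 d \<in> S \<or> rot n 3 d \<in> Z" if "d \<in> D" for d
    using cases[of "rot n 3 d"] D1[OF that] DS rot_less by (auto simp: rot_rot)
  \<comment> \<open>Jump 1 would join \<open>rot n (-1) d\<close> to \<open>d\<close> and jump 4
    would join it to \<open>rot n 3 d\<close>, so these two would share a label. The next claim uses
    \<open>rot n 4 d\<close> in the same way.\<close>
  have d3S: "rot n (-1) d \<notin> S" if "d \<in> D" "rot n 3 d \<in> S" for d
  proof
    assume a: "rot n (-1) d \<in> S"
    have "rot n 1 (rot n (-1) d) = d" "rot n 4 (rot n (-1) d) = rot n 3 d"
      using that DS lt by (auto simp: rot_rot rot_0)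
    then have "f d = f (rot n (-1) d)" "f (rot n 3 d) = f (rot n (-1) d)"
      using f[OF a, of 1] f[OF a, of 4] that DS by auto
    then show False using D1(3)[OF that] by simp
  qed
  have d4: "rot n 4 d \<notin> S" if "d \<in> D" "rot n 3 d \<in> S" for d
  proof
    assume "rot n 4 d \<in> S"
    then have "f (rot n 4 d) = f d" "f (rot n 4 d) = f (rot n 3 d)"
      using f[of d 4] f[of "rot n 3 d" 1] that DS by (auto simp: rot_rot)
    then show False using D1(3)[OF that] by simp
  qed
  \<comment> \<open>A run of remaining vertices outside \<open>D\<close> can only stop at
    \<open>Z\<close> or at a block end; in the latter case \<open>d3S\<close> and \<open>d3\<close>
    put the vertex three after that block end into \<open>Z\<close>.\<close>
  have forward: "rot n 1 s \<in> S - D \<or> rot n 1 s \<in> Z \<or> rot n 1 s \<in> D \<and> rot n 4 s \<in> Z"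
    if "s \<in> S - D" for s
  proof (cases "rot n 1 s \<in> D")
    case True
    then have "rot n 3 (rot n 1 s) \<notin> S" using d3S[OF True] that lt by (auto simp: rot_rot rot_0)
    then show ?thesis using d3[OF True] True by (simp add: rot_rot)
  next
    case False
    have "rot n (-1) (rot n 1 s) = s" "rot n (-2) (rot n 1 s) = rot n (-1) s"
      "rot n 1 (rot n (-1) s) = s"
      using that lt by (auto simp: rot_rot rot_0)
    then show ?thesis
      using cases[of "rot n 1 s"] D1(1)[of "rot n (-1) s"] False that rot_less by auto
  qed
  \<comment> \<open>Otherwise the two positions before \<open>s\<close> are the successors of the
    block end \<open>rot n (-3) s\<close>; then \<open>d4\<close> deletes \<open>rot n 1 s\<close>,
    which \<open>forward\<close> permits only inside \<open>Z\<close>.\<close>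
  have backward: "rot n (-1) s \<in> S - D \<or> rot n (-1) s \<in> Z \<or> rot n 1 s \<in> Z"
    if "s \<in> S - D" for s
  proof (rule ccontr)
    assume *: "\<not> ?thesis"
    have "rot n 1 (rot n (-1) s) = s" "rot n 2 (rot n (-2) s) = s" "rot n 3 (rot n (-3) s) = s"
      using that lt by (auto simp: rot_rot rot_0)
    then have "rot n (-3) s \<in> D"
      using cases[of "rot n (-1) s"] D1(1)[of "rot n (-1) s"] D1(2)[of "rot n (-2) s"] * that rot_less
      by (auto simp: rot_rot)
    then have "rot n 1 s \<notin> S" using d4[of "rot n (-3) s"] that lt by (auto simp: rot_rot rot_0)
    then show False using forward[OF that] * DS by auto
  qed
  have c_le: "?c \<le> card S" using finS by (rule card_image_le)
  have n4: "4 < n" using n_eq c2 c_le by linarith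
  have closed: "T = {}" if "T \<subseteq> S - D" "\<And>x. x \<in> T \<Longrightarrow> rot n 1 x \<in> T" for T
  proof (rule ccontr)
    assume "T \<noteq> {}"
    then have "T = {..<n}" using rot_closed_eq[of T] that S by blast
    then have "D = {}" using that DS S by auto
    then show False using cardD c2 by auto
  qed
  show False
  proof (cases "Z = {}")
    case True
    have "S - D = {}"
    proof (rule closed)
      fix x assume "x \<in> S - D"
      then show "rot n 1 x \<in> S - D" using forward True by blast
    qed simp
    then have "card S = ?c" using DS cardD by (metis Diff_eq_empty_iff subset_antisym)
    then have "n = 3 * ?c" using n_eq True by simp
    then show False using n3 by simp
  next
    case False
    then obtain z where z: "Z = {z}" using Z_eq by blast
    have zn: "z < n" "z \<notin> S" using z unfolding Z_def by auto
    have zD: "rot n (-1) z \<notin> D" "rot n (-2) z \<notin> D"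
    proof -
      have "z = rot n 1 (rot n (-1) z)" "z = rot n 2 (rot n (-2) z)"
        using zn by (simp_all add: rot_rot rot_0)
      moreover have "z \<notin> ?A" "z \<notin> ?B" using z unfolding Z_def by auto
      ultimately show "rot n (-1) z \<notin> D" "rot n (-2) z \<notin> D" by (metis imageI)+
    qed
    have unrot: "s = rot n (-j) z" if "s \<in> S" "rot n j s = z" for s j
      using that lt by (auto simp: rot_rot rot_0)
    have z1: "rot n 1 z \<notin> S - D"
    proof
      assume a: "rot n 1 z \<in> S - D"
      \<comment> \<open>By \<open>forward\<close> a run leaves \<open>S - D\<close> only towards
        \<open>z\<close> or \<open>rot n (-3) z\<close>. Adding the four positions up to
        \<open>z\<close>, with \<open>a\<close> for the step after \<open>z\<close>, closes the set
        under successors. It is then the whole cycle, so \<open>zD\<close> leaves only one position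
        for \<open>D\<close>, which has at least two elements.\<close>
      let ?T = "(S - D) \<union> {rot n (-3) z, rot n (-2) z, rot n (-1) z, z}"
      have "?T = {..<n}"
      proof (rule rot_closed_eq)
        show "?T \<subseteq> {..<n}" using S rot_less zn by auto
        fix x assume "x \<in> ?T"
        then consider "x \<in> S - D" | "x \<in> {rot n (-3) z, rot n (-2) z, rot n (-1) z, z}" by blast
        then show "rot n 1 x \<in> ?T"
        proof cases
          case 1
          have "rot n 1 x = rot n (-3) z" if "rot n 4 x = z"
            using unrot[of x 4] 1 that by (auto simp: rot_rot)
          then show ?thesis using forward[OF 1] z by auto
        next
          case 2
          then show ?thesis using a zn by (auto simp: rot_rot rot_0)
        qed
      qed auto
      then have "D \<subseteq> {rot n (-3) z}" using DS S zD zn by blast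
      then have "card D \<le> card {rot n (-3) z}" by (intro card_mono) auto
      then show False using cardD c2 by simp
    qed
    \<comment> \<open>Removing the predecessor of \<open>z\<close>, together with \<open>z1\<close>,
      excludes the exceptions in \<open>backward\<close>, so \<open>?T\<close> is closed under
      predecessors. Its complement contains \<open>z\<close> and is closed under successors, hence
      is the whole cycle.\<close>
    let ?T = "S - D - {rot n (-1) z}"
    have Tm: "rot n (-1) x \<in> ?T" if "x \<in> ?T" for x
    proof -
      have x: "x \<in> S - D" "x \<noteq> rot n (-1) z" "x < n" using that lt by auto
      then have "rot n 1 x \<noteq> z" using unrot by auto
      moreover have "rot n (-1) x \<noteq> z" using x z1 by (auto simp: rot_rot rot_0)
      moreover have "rot n (-1) x \<noteq> rot n (-1) z" using x zn rot_inject by blast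
      ultimately show ?thesis using backward[OF x(1)] z by auto
    qed
    have "?T = {}"
    proof -
      have "{..<n} - ?T = {..<n}"
      proof (rule rot_closed_eq)
        show "{..<n} - ?T \<noteq> {}" using zn by auto
        fix x assume "x \<in> {..<n} - ?T"
        then show "rot n 1 x \<in> {..<n} - ?T"
          using Tm[of "rot n 1 x"] rot_less by (auto simp: rot_rot rot_0)
      qed auto
      then show ?thesis using S by blast
    qed
    then have w: "S - D \<subseteq> {rot n (-1) z}" by blast
    show False
    proof (cases "S = D")
      case True
      \<comment> \<open>Here \<open>n = 3 * ?c + 1\<close>, which \<open>n3\<close> admits. Jump 4
        decides: it joins the block ends \<open>rot n (-3) z\<close> and \<open>rot n 1 z\<close>,
        which are distinct by \<open>n4\<close> and so have different labels.\<close>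
      have ne: "rot n (-1) z \<noteq> z" "rot n 1 z \<noteq> z" "rot n 4 (rot n (-3) z) \<noteq> rot n (-3) z"
        using rot_eq_iff[of "-1" z 0] rot_eq_iff[of 1 z 0] rot_eq_iff[of 1 z "-3"] zn n4
        by (auto simp: rot_0 rot_rot dest: zdvd_imp_le)
      have "rot n (-3) z \<in> D"
        using cases[of "rot n (-1) z"] True zD z ne rot_less by (auto simp: rot_rot)
      moreover have "rot n 1 z \<in> S"
        using cases[of "rot n 1 z"] True zD zn z ne rot_less by (auto simp: rot_rot rot_0)
      then have "rot n 4 (rot n (-3) z) \<in> S" by (simp add: rot_rot)
      ultimately show False using f[of "rot n (-3) z" 4] injf ne True by (auto dest: inj_onD)
    next
      case False
      then have "S - D = {rot n (-1) z}" using w DS by blast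
      then have "card (S - D) = 1" by simp
      then have "card S = ?c + 1" using cardD DS finD finS card_mono[OF finS DS]
        by (simp add: card_Diff_subset)
      then have "n = 3 * ?c + 2" using n_eq z by simp
      then show False using n3 by presburger
    qed
  qed
qed

end

section \<open>Components and toughness in terms of labellings\<close>

text \<open>Since adjacency is symmetric, the strong components form a labelling with exactly the
  right number of values. Any labelling constant along edges is constant on components and takes at
  most that many values.\<close>

lemma components_labelling:
  assumes "pair_graph H" and S: "S \<subseteq> pverts H"
  shows "\<exists>f :: 'a \<Rightarrow> 'a set. card (f ` S) = num_components (with_proj H \<restriction> S)
      \<and> (\<forall>u\<in>S. \<forall>v\<in>S. (u, v) \<in> parcs H \<longrightarrow> f u = f v)"
    and "(\<And>u v. u \<in> S \<Longrightarrow> v \<in> S \<Longrightarrow> (u, v) \<in> parcs H \<Longrightarrow> g u = g v) \<Longrightarrow>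
      card (g ` S) \<le> num_components (with_proj H \<restriction> S)"
proof -
  interpret H: pair_graph H by fact
  let ?R = "with_proj H \<restriction> S"
  have arcsR: "arcs_ends ?R = {(u, v). (u, v) \<in> parcs H \<and> u \<in> S \<and> v \<in> S}"
    by (auto simp: arcs_ends_def arc_to_ends_def)
  interpret R: sym_digraph ?R
  proof unfold_locales
    show "symmetric ?R" unfolding symmetric_def arcsR using H.arcs_symmetric by (auto intro!: symI)
    fix e assume "e \<in> arcs ?R"
    then show "tail ?R e \<in> verts ?R" "head ?R e \<in> verts ?R" by simp_all
  qed
  have finS: "finite S" using S H.pair_finite_verts finite_subset by blast
  have refl: "u \<in> R.scc_of u" if "u \<in> S" for u using that by (simp add: R.scc_of_def)
  have scc_eq: "R.scc_of u = {v. u \<rightarrow>\<^sup>*\<^bsub>?R\<^esub> v}" for u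
    using symmetric_reachable[OF R.sym_arcs] by (auto simp: R.scc_of_def)
  have "R.sccs_verts = R.scc_of ` S"
  proof (intro equalityI subsetI)
    fix C assume C: "C \<in> R.sccs_verts"
    then obtain u where u: "u \<in> C" by (auto simp: R.in_sccs_verts_conv_reachable)
    then have "u \<in> S" using C R.reachable_in_verts(1)[of u u]
      by (auto simp: R.in_sccs_verts_conv_reachable)
    moreover have "C = R.scc_of u"
      using C u by (auto simp: R.in_sccs_verts_conv_reachable R.scc_of_def)
    ultimately show "C \<in> R.scc_of ` S" by blast
  next
    fix C assume "C \<in> R.scc_of ` S"
    then obtain u where "u \<in> S" "C = R.scc_of u" by blast
    then show "C \<in> R.sccs_verts"
      using refl unfolding R.in_sccs_verts_conv_reachable
      by (auto simp: R.scc_of_def intro: R.reachable_trans)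
  qed
  then have num: "num_components ?R = card (R.scc_of ` S)" by (simp add: R.num_components_eq)
  have "R.scc_of u = R.scc_of v" if "u \<in> S" "v \<in> S" "(u, v) \<in> parcs H" for u v
  proof -
    have "u \<rightarrow>\<^bsub>?R\<^esub> v" "v \<rightarrow>\<^bsub>?R\<^esub> u" using that H.arcs_symmetric by (auto simp: arcsR)
    then show ?thesis unfolding scc_eq by (auto intro: R.adj_reachable_trans)
  qed
  then show "\<exists>f :: 'a \<Rightarrow> 'a set. card (f ` S) = num_components ?R
      \<and> (\<forall>u\<in>S. \<forall>v\<in>S. (u, v) \<in> parcs H \<longrightarrow> f u = f v)"
    using num by (intro exI[of _ R.scc_of]) simp
  assume g: "\<And>u v. u \<in> S \<Longrightarrow> v \<in> S \<Longrightarrow> (u, v) \<in> parcs H \<Longrightarrow> g u = g v"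
  have g_reach: "g u = g v" if "u \<rightarrow>\<^sup>*\<^bsub>?R\<^esub> v" for u v
    using that
  proof (induct rule: R.reachable_induct)
    case (step x y)
    then show ?case using g[of x y] by (auto simp: arcsR)
  qed simp
  \<comment> \<open>\<open>SOME\<close> picks a representative of each component, so
    \<open>g\<close> factors through \<open>R.scc_of\<close>.\<close>
  have "g u = g (SOME v. v \<in> R.scc_of u)" if "u \<in> S" for u
    using g_reach someI[of "\<lambda>v. v \<in> R.scc_of u", OF refl[OF that]] by (auto simp: scc_eq)
  then have "g ` S \<subseteq> (\<lambda>C. g (SOME v. v \<in> C)) ` R.scc_of ` S" by auto
  then show "card (g ` S) \<le> num_components ?R"
    unfolding num using finS by (meson card_image_le card_mono finite_imageI le_trans)
qed

lemma toughD:
  fixes t :: real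
  assumes "pair_graph H" "tough t H" "0 \<le> t" "S \<subseteq> pverts H"
    and "\<And>u v. u \<in> S \<Longrightarrow> v \<in> S \<Longrightarrow> (u, v) \<in> parcs H \<Longrightarrow> f u = f v"
    and "1 < card (f ` S)"
  shows "t * card (f ` S) \<le> card (pverts H - S)"
proof -
  have "pverts H - (pverts H - S) = S" using assms by blast
  moreover have le: "card (f ` S) \<le> num_components (with_proj H \<restriction> S)"
    using components_labelling(2) assms by blast
  ultimately have "t * num_components (with_proj H \<restriction> S) \<le> card (pverts H - S)"
    using assms(2,6) unfolding tough_def Let_def by (metis Diff_subset le_trans less_le_trans)
  moreover have "t * card (f ` S) \<le> t * num_components (with_proj H \<restriction> S)"
    using le assms by (intro mult_left_mono) auto
  ultimately show ?thesis by linarith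
qed

text \<open>The attained maximum satisfies the inequality of \<open>toughD\<close> for
  \<open>S\<close> and \<open>f\<close>, which fails for \<open>t\<close>; a labelled remaining set
  thus certifies a strict upper bound.\<close>

lemma toughness_less:
  fixes t :: real
  assumes "pair_graph H" "pverts H \<noteq> {}" "\<not> (\<exists>n\<ge>1. K\<^bsub>n\<^esub> (with_proj H))" "S \<subseteq> pverts H"
    and "\<And>u v. u \<in> S \<Longrightarrow> v \<in> S \<Longrightarrow> (u, v) \<in> parcs H \<Longrightarrow> f u = f v"
    and "1 < card (f ` S)" "card (pverts H - S) < t * card (f ` S)"
  shows "toughness H < ereal t"
proof -
  obtain s where s: "toughness H = ereal s" "0 \<le> s" "tough s H"
    using toughness_attained[OF assms(1-3)] by metis
  have "s * card (f ` S) < t * card (f ` S)"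
    using toughD[OF assms(1) s(3,2) assms(4-6)] assms(7) by simp
  then have "s < t" by (simp add: mult_less_cancel_right)
  then show ?thesis using s by simp
qed

lemma toughness_eqI:
  fixes t :: real
  assumes "pair_graph H" "pverts H \<noteq> {}" "\<not> (\<exists>n\<ge>1. K\<^bsub>n\<^esub> (with_proj H))" "S \<subseteq> pverts H"
    and "\<And>u v. u \<in> S \<Longrightarrow> v \<in> S \<Longrightarrow> (u, v) \<in> parcs H \<Longrightarrow> f u = f v"
    and "1 < card (f ` S)" "card (pverts H - S) \<le> t * card (f ` S)"
    and "0 \<le> t" "tough t H"
  shows "toughness H = ereal t"
proof -
  obtain s where s: "toughness H = ereal s" "0 \<le> s" "tough s H" "t \<le> s"
    using toughness_attained[OF assms(1-3)] assms(8,9) by metis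
  have "s * card (f ` S) \<le> t * card (f ` S)"
    using toughD[OF assms(1) s(3,2) assms(4-6)] assms(7) by simp
  then have "s \<le> t" using assms(6) by simp
  then show ?thesis using s by simp
qed

section \<open>The circulant graph with jumps 1, 2 and 4\<close>

text \<open>Each jump appears with both signs, which makes the arc set symmetric.\<close>

definition circ :: "nat \<Rightarrow> nat pair_pre_digraph" where
  "circ n = \<lparr>pverts = {..<n}, parcs = {(u, rot n j u) |u j. u < n \<and> j \<in> {1, 2, 4, -1, -2, -4}}\<rparr>"

lemma pverts_circ [simp]: "pverts (circ n) = {..<n}"
  by (simp add: circ_def)

lemma in_parcs_circ_iff:
  "(u, v) \<in> parcs (circ n) \<longleftrightarrow> u < n \<and> (\<exists>j\<in>{1, 2, 4, -1, -2, -4}. v = rot n j u)"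
  by (auto simp: circ_def)

lemma rot_eq_iff_small:
  assumes "\<bar>i - j\<bar> < int n"
  shows "rot n i x = rot n j x \<longleftrightarrow> i = j"
proof -
  have "0 < n" using assms by linarith
  then show ?thesis using assms zdvd_imp_le[of "int n" "\<bar>i - j\<bar>"] by (auto simp: rot_eq_iff)
qed

lemma pair_graph_circ:
  assumes "4 < n"
  shows "pair_graph (circ n)"
proof
  have n: "0 < n" using assms by simp
  have "parcs (circ n) \<subseteq> {..<n} \<times> {..<n}" using rot_less[OF n] by (auto simp: circ_def)
  then show "finite (parcs (circ n))" "\<And>e. e \<in> parcs (circ n) \<Longrightarrow> fst e \<in> pverts (circ n)"
    "\<And>e. e \<in> parcs (circ n) \<Longrightarrow> snd e \<in> pverts (circ n)"
    by (auto intro: finite_subset)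
  show "symmetric (with_proj (circ n))"
    unfolding symmetric_def
  proof (rule symI)
    fix u v assume "(u, v) \<in> arcs_ends (with_proj (circ n))"
    then obtain j where j: "u < n" "j \<in> {1, 2, 4, -1, -2, -4}" "v = rot n j u"
      by (auto simp: in_parcs_circ_iff)
    then have "u = rot n (-j) v" by (simp add: rot_rot[OF n] rot_0[OF n])
    moreover have "-j \<in> {1, 2, 4, -1, -2, -4}" using j by auto
    ultimately show "(v, u) \<in> arcs_ends (with_proj (circ n))"
      using j rot_less[OF n] by (auto simp: in_parcs_circ_iff)
  qed
  fix e assume "e \<in> parcs (circ n)"
  then obtain u j where j: "e = (u, rot n j u)" "u < n" "j \<in> {1, 2, 4, -1, -2, -4}"
    by (auto simp: circ_def)
  then have "rot n j u \<noteq> rot n 0 u" using assms by (subst rot_eq_iff_small) auto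
  then show "fst e \<noteq> snd e" using j by (simp add: rot_0[OF n])
qed simp_all

text \<open>Any two of the six jumps differ by at most 8, so for \<open>8 < n\<close> they lead to
  six distinct neighbours.\<close>

lemma regular_circ:
  assumes "8 < n"
  shows "regular 6 (circ n)"
  unfolding regular_def
proof
  fix v assume v: "v \<in> pverts (circ n)"
  let ?J = "{1, 2, 4, -1, -2, -4 :: int}"
  have "out_arcs (with_proj (circ n)) v = (\<lambda>j. (v, rot n j v)) ` ?J"
    using v by (auto simp: out_arcs_def circ_def)
  moreover have "inj_on (\<lambda>j. (v, rot n j v)) ?J"
  proof (rule inj_onI)
    fix i j assume "i \<in> ?J" "j \<in> ?J" "(v, rot n i v) = (v, rot n j v)"
    moreover have "\<bar>i - j\<bar> < int n" using calculation assms by auto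
    ultimately show "i = j" by (simp add: rot_eq_iff_small)
  qed
  ultimately show "out_degree (with_proj (circ n)) v = 6"
    by (simp add: out_degree_def card_image)
qed

text \<open>Turns a witness given by offsets \<open>W\<close> from a base vertex \<open>x\<close>,
  with labels \<open>h\<close>, into the labelled set that the toughness lemmas need. Letting
  \<open>H\<close> be a subgraph on the same vertices covers the circulant and its edge deletions at
  once.\<close>

lemma circ_labelling:
  fixes h :: "nat \<Rightarrow> 'b"
  assumes n: "4 < n" and H: "pverts H = {..<n}" "parcs H \<subseteq> parcs (circ n)" "pair_graph H"
    and x: "x < n" and W: "W \<subseteq> {..<n}"
    and h: "\<And>i i'. i \<in> W \<Longrightarrow> i' \<in> W \<Longrightarrow> i < i' \<Longrightarrow>
      (rot n (int i) x, rot n (int i') x) \<in> parcs H \<Longrightarrow>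
      i' = i + 1 \<or> i' = i + 2 \<or> i' = i + 4 \<or> i' + 1 = i + n \<or> i' + 2 = i + n \<or> i' + 4 = i + n \<Longrightarrow>
      h i = h i'"
  shows "\<exists>S (f :: nat \<Rightarrow> 'b). S \<subseteq> pverts H \<and> card (pverts H - S) = n - card W \<and> card (f ` S) = card (h ` W)
    \<and> (\<forall>u\<in>S. \<forall>v\<in>S. (u, v) \<in> parcs H \<longrightarrow> f u = f v)"
proof -
  have n0: "0 < n" using n by simp
  define r where "r i = rot n (int i) x" for i
  have inj: "inj_on r W"
  proof (rule inj_onI)
    fix i j assume "i \<in> W" "j \<in> W" "r i = r j"
    moreover have "\<bar>int i - int j\<bar> < int n" using calculation W by (auto simp: abs_if)
    ultimately show "i = j" by (simp add: r_def rot_eq_iff_small)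
  qed
  interpret H: pair_graph H by fact
  have hr: "h i = h i'" if "i \<in> W" "i' \<in> W" "i < i'" "(r i, r i') \<in> parcs H" for i i'
  proof -
    note arc = that(4)
    obtain j where j: "j \<in> {1, 2, 4, -1, -2, -4}" "r i' = rot n j (r i)"
      using subsetD[OF H(2) arc] by (auto simp: in_parcs_circ_iff)
    then have "rot n (int i') x = rot n (int i + j) x" by (simp add: r_def rot_rot[OF n0])
    then have "int n dvd int i' - (int i + j)" by (simp add: rot_eq_iff[OF n0])
    then obtain q where q: "int i' - (int i + j) = int n * q" by (auto simp: dvd_def)
    have lt: "i' < n" using W that by auto
    have "-4 \<le> j" "j \<le> 4" using j by auto
    \<comment> \<open>Offsets differ by less than \<open>n\<close> and a jump has size at most 4, so
      an arc wraps around the cycle at most once: \<open>q = 0\<close> is a direct jump,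
      \<open>q = 1\<close> a wrapped one.\<close>
    then have "int n * q < int n * 2" "int n * (-1) < int n * q" using q that(3) n lt by linarith+
    then have "q < 2" "-1 < q" using n0 by (simp_all only: mult_less_cancel_left_pos of_nat_0_less_iff)
    then have "q = 0 \<or> q = 1" by linarith
    then have "i' = i + 1 \<or> i' = i + 2 \<or> i' = i + 4 \<or> i' + 1 = i + n \<or> i' + 2 = i + n \<or> i' + 4 = i + n"
      using q j lt that by auto
    then show ?thesis using h that by (simp add: r_def)
  qed
  let ?S = "r ` W" and ?f = "\<lambda>v. h (the_inv_into W r v)"
  have fr: "?f (r i) = h i" if "i \<in> W" for i using that inj by (simp add: the_inv_into_f_f)
  have S: "?S \<subseteq> pverts H" using H rot_less[OF n0] by (auto simp: r_def)
  moreover have "card (pverts H - ?S) = n - card W"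
    using S inj finite_subset[OF S] H by (subst card_Diff_subset) (auto simp: card_image)
  moreover have "?f ` ?S = h ` W" using fr by force
  moreover have "\<And>u v. u \<in> ?S \<Longrightarrow> v \<in> ?S \<Longrightarrow> (u, v) \<in> parcs H \<Longrightarrow> ?f u = ?f v"
  proof -
    fix u v assume uv: "u \<in> ?S" "v \<in> ?S" "(u, v) \<in> parcs H"
    obtain i i' where i: "u = r i" "v = r i'" "i \<in> W" "i' \<in> W" using uv by auto
    have arc: "(r i, r i') \<in> parcs H" "(r i', r i) \<in> parcs H"
      using i uv H.arcs_symmetric by blast+
    have "h i = h i'"
      using hr[OF i(3,4) _ arc(1)] hr[OF i(4,3) _ arc(2)] by (metis linorder_neqE_nat)
    then show "?f u = ?f v" using i fr by simp
  qed
  ultimately show ?thesis by (intro exI[of _ ?S] exI[of _ ?f]) simp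
qed

section \<open>Lower bound for the toughness\<close>

lemma tough_circ:
  assumes k: "3 \<le> k"
  shows "tough (2 * real k / (real k - 1)) (circ (3 * k + 1))"
  unfolding tough_def Let_def
proof (intro allI impI)
  let ?n = "3 * k + 1"
  let ?G = "circ ?n"
  have n: "4 < ?n" "0 < ?n" using k by auto
  note G = pair_graph_circ[OF n(1)]
  fix X assume X: "X \<subseteq> pverts ?G" and c: "1 < num_components (with_proj ?G \<restriction> (pverts ?G - X))"
  let ?S = "pverts ?G - X"
  let ?c = "num_components (with_proj ?G \<restriction> ?S)"
  obtain f :: "nat \<Rightarrow> nat set" where f: "card (f ` ?S) = ?c"
    "\<And>u v. u \<in> ?S \<Longrightarrow> v \<in> ?S \<Longrightarrow> (u, v) \<in> parcs ?G \<Longrightarrow> f u = f v"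
    using components_labelling(1)[OF G, of ?S] by blast
  have "2 * card (f ` ?S) + 2 \<le> card ({..<?n} - ?S)"
  proof (rule card_separator_ge[OF n(2)])
    show "f (rot ?n j x) = f x" if "x \<in> ?S" "j \<in> {1, 2, 4}" "rot ?n j x \<in> ?S" for x j
      using f(2)[of x "rot ?n j x"] that by (auto simp: in_parcs_circ_iff)
  qed (use c f in auto)
  moreover have "{..<?n} - ?S = X" using X by auto
  ultimately have X2: "2 * ?c + 2 \<le> card X" using f by simp
  have "?c \<le> card ?S" using f(1) card_image_le[of ?S f] by simp
  also have "card ?S = ?n - card X" using X finite_subset[OF X] by (subst card_Diff_subset) auto
  \<comment> \<open>Each component keeps a vertex, so \<open>3 * ?c + 2\<close> is at most
    \<open>3 * k + 1\<close>.\<close>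
  finally have "?c + 1 \<le> k" using X2 c by linarith
  then have c_le: "real ?c \<le> real k - 1" by linarith
  \<comment> \<open>The right side exceeds the left by \<open>2 * (real k - 1 - ?c)\<close>.\<close>
  have "2 * real k * ?c \<le> (2 * ?c + 2) * (real k - 1)"
    using c_le by (simp add: algebra_simps)
  also have "\<dots> \<le> card X * (real k - 1)" using X2 k by (intro mult_right_mono) auto
  finally show "2 * real k / (real k - 1) * ?c \<le> card X" using k by (simp add: field_simps)
qed

section \<open>Witness sets and the exact toughness\<close>

text \<open>
  The offsets that remain in the witness without a deleted edge and in the witnesses for a deleted
  edge from 0 to 1, 2 and 4, respectively: the only adjacent ones lie in one component, up to the
  deleted edge.
\<close>

context
  fixes k i i' :: nat
  assumes k: "3 \<le> k" and less: "i < i'"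
    and close: "i' = i + 1 \<or> i' = i + 2 \<or> i' = i + 4 \<or>
      i' + 1 = i + (3 * k + 1) \<or> i' + 2 = i + (3 * k + 1) \<or> i' + 4 = i + (3 * k + 1)"
begin

lemma close_offsets_none:
  assumes "i = 0 \<or> i = 2 \<or> i = 4 \<or> i mod 3 = 1 \<and> 7 \<le> i \<and> i + 2 \<le> 3 * k"
    and "i' = 0 \<or> i' = 2 \<or> i' = 4 \<or> i' mod 3 = 1 \<and> 7 \<le> i' \<and> i' + 2 \<le> 3 * k"
  shows "i \<le> 4 \<and> i' \<le> 4"
  \<comment> \<open>Offsets congruent modulo 3 cannot differ by 1, 2, 4 or \<open>3 * k - 1\<close>,
    and within the regular family the bounds exclude the differences \<open>3 * k\<close> and
    \<open>3 * k - 3\<close>. The few irregular offsets are separate cases.\<close>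
  using close assms k less by (elim disjE conjE) (linarith | presburger)+

lemma close_offsets_1:
  assumes "i = 0 \<or> i = 1 \<or> i = 3 \<or> i + 1 = 3 * k \<or> i mod 3 = 0 \<and> 6 \<le> i \<and> i + 3 \<le> 3 * k"
    and "i' = 0 \<or> i' = 1 \<or> i' = 3 \<or> i' + 1 = 3 * k \<or> i' mod 3 = 0 \<and> 6 \<le> i' \<and> i' + 3 \<le> 3 * k"
  shows "i = 0 \<and> i' = 1 \<or> i = 1 \<and> i' = 3 \<or> (i = 0 \<or> 3 * k \<le> i + 3) \<and> 3 * k \<le> i' + 3"
  using close assms k less by (elim disjE conjE) (linarith | presburger)+

lemma close_offsets_2:
  assumes "i = 0 \<or> i + 2 = 3 * k \<or> i mod 3 = 2 \<and> i + 4 \<le> 3 * k"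
    and "i' = 0 \<or> i' + 2 = 3 * k \<or> i' mod 3 = 2 \<and> i' + 4 \<le> 3 * k"
  shows "i = 0 \<and> i' = 2 \<or> i + 4 = 3 * k \<and> i' + 2 = 3 * k"
  using close assms k less by (elim disjE conjE) (linarith | presburger)+

lemma close_offsets_4:
  assumes "i = 0 \<or> i mod 3 = 1 \<and> 4 \<le> i \<and> i + 2 \<le> 3 * k"
    and "i' = 0 \<or> i' mod 3 = 1 \<and> 4 \<le> i' \<and> i' + 2 \<le> 3 * k"
  shows "i = 0 \<and> i' = 4"
  using close assms k less by (elim disjE conjE) (linarith | presburger)+

end

lemma not_complete:
  assumes "u \<in> pverts H" "v \<in> pverts H" "u \<noteq> v" "(u, v) \<notin> parcs H"
  shows "\<not> (\<exists>n\<ge>1. K\<^bsub>n\<^esub> (with_proj H))"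
  using assms by (auto simp: complete_digraph_pair_def)

lemma toughness_circ:
  assumes k: "3 \<le> k"
  shows "toughness (circ (3 * k + 1)) = ereal (2 * real k / (real k - 1))"
proof -
  let ?n = "3 * k + 1"
  let ?G = "circ ?n"
  have n: "4 < ?n" "0 < ?n" using k by auto
  note G = pair_graph_circ[OF n(1)]
  have ne: "rot ?n 3 0 \<noteq> rot ?n j 0" if "j \<in> {0, 1, 2, 4, -1, -2, -4}" for j
    using that k by (subst rot_eq_iff_small) auto
  have "0 \<noteq> rot ?n 3 0" using ne[of 0] rot_0[OF n(2) n(2)] by simp
  moreover have "(0, rot ?n 3 0) \<notin> parcs ?G" using ne unfolding in_parcs_circ_iff by blast
  ultimately have nc: "\<not> (\<exists>n\<ge>1. K\<^bsub>n\<^esub> (with_proj ?G))"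
    using rot_less[OF n(2)] by (intro not_complete[of 0 _ "rot ?n 3 0"]) simp_all
  \<comment> \<open>Offsets 0, 2, 4 form one component and \<open>7, 10, ..., 3 * k - 2\<close> are
    isolated: \<open>k - 1\<close> components after \<open>2 * k\<close> deletions.\<close>
  let ?A = "(\<lambda>i. 3 * i + 7) ` {..<k - 2}"
  let ?W = "{0, 2, 4} \<union> ?A"
  let ?h = "\<lambda>i::nat. if i \<le> 4 then 0 else i"
  have A: "card ?A = k - 2" by (subst card_image) (auto simp: inj_on_def)
  have W: "?W \<subseteq> {..<?n}" using k by auto
  have "\<exists>S (f :: nat \<Rightarrow> nat). S \<subseteq> pverts ?G \<and> card (pverts ?G - S) = ?n - card ?W \<and> card (f ` S) = card (?h ` ?W)
    \<and> (\<forall>u\<in>S. \<forall>v\<in>S. (u, v) \<in> parcs ?G \<longrightarrow> f u = f v)"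
  proof (rule circ_labelling[OF n(1) _ _ G n(2) W])
    fix i i' assume W: "i \<in> ?W" "i' \<in> ?W" "i < i'"
      and d: "i' = i + 1 \<or> i' = i + 2 \<or> i' = i + 4 \<or> i' + 1 = i + ?n \<or> i' + 2 = i + ?n \<or> i' + 4 = i + ?n"
    have "i = 0 \<or> i = 2 \<or> i = 4 \<or> i mod 3 = 1 \<and> 7 \<le> i \<and> i + 2 \<le> 3 * k"
      "i' = 0 \<or> i' = 2 \<or> i' = 4 \<or> i' mod 3 = 1 \<and> 7 \<le> i' \<and> i' + 2 \<le> 3 * k"
      using W by auto
    then have "i \<le> 4 \<and> i' \<le> 4"
      by (rule close_offsets_none[OF k W(3) d])
    then show "?h i = ?h i'" by simp
  qed simp_all
  then obtain S and f :: "nat \<Rightarrow> nat" where S: "S \<subseteq> pverts ?G" "card (pverts ?G - S) = ?n - card ?W"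
    "card (f ` S) = card (?h ` ?W)"
    "\<And>u v. u \<in> S \<Longrightarrow> v \<in> S \<Longrightarrow> (u, v) \<in> parcs ?G \<Longrightarrow> f u = f v"
    by blast
  have "card ?W = k + 1" using A k by (subst card_Un_disjoint) auto
  moreover have "?h ` ?W = insert 0 ?A" by (auto simp: image_iff)
  moreover have "card (insert 0 ?A) = k - 1" using A k by (subst card_insert_disjoint) auto
  ultimately have "card (pverts ?G - S) = 2 * k" "card (f ` S) = k - 1" using S(2,3) by simp_all
  then show ?thesis
    using k S tough_circ[OF k] by (intro toughness_eqI[OF G _ nc, of S f]) (auto simp: of_nat_diff)
qed

section \<open>Minimality under edge deletion\<close>

lemma del_edge_simps [simp]:
  "pverts (del_edge G e) = pverts G" "parcs (del_edge G e) = parcs G - {e, (snd e, fst e)}"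
  by (simp_all add: del_edge_def)

lemma pair_graph_del_edge:
  assumes "pair_graph G"
  shows "pair_graph (del_edge G e)"
proof -
  interpret pair_graph G by fact
  show ?thesis
  proof
    show "symmetric (with_proj (del_edge G e))"
      unfolding symmetric_def using arcs_symmetric by (auto intro!: symI)
  qed (use pair_finite_verts pair_finite_arcs pair_no_loops arc_fst_in_verts arc_snd_in_verts in auto)
qed

lemma toughness_del_edge_circ:
  assumes k: "3 \<le> k" and e: "e \<in> parcs (circ (3 * k + 1))"
  shows "toughness (del_edge (circ (3 * k + 1)) e) < ereal (2 * real k / (real k - 1))"
proof -
  let ?n = "3 * k + 1"
  let ?G = "circ ?n"
  let ?H = "del_edge ?G e"
  have n: "4 < ?n" "0 < ?n" using k by auto
  note G = pair_graph_circ[OF n(1)]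
  note H = pair_graph_del_edge[OF G, of e]
  interpret G: pair_graph ?G by (rule G)
  have nc: "\<not> (\<exists>n\<ge>1. K\<^bsub>n\<^esub> (with_proj ?H))"
    using G.arc_fst_in_verts[OF e] G.arc_snd_in_verts[OF e] G.pair_no_loops[OF e]
    by (intro not_complete[of "fst e" _ "snd e"]) auto
  \<comment> \<open>As \<open>del_edge\<close> removes both arcs, a negative jump can be read from
    its other end. Offsets are then measured from \<open>x\<close>, so three witnesses
    suffice.\<close>
  obtain x j where x: "x < ?n" "j \<in> {1, 2, 4 :: nat}"
    "e = (x, rot ?n (int j) x) \<or> e = (rot ?n (int j) x, x)"
  proof -
    obtain u i where u: "u < ?n" "e = (u, rot ?n i u)" "i \<in> {1, 2, 4, -1, -2, -4}"
      using e by (cases e) (auto simp: in_parcs_circ_iff)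
    show ?thesis
    proof (cases "0 < i")
      case True
      then show ?thesis using that[of u "nat i"] u by auto
    next
      case False
      then have "rot ?n (int (nat (-i))) (rot ?n i u) = u"
        unfolding rot_rot[OF n(2)] using rot_0[OF n(2) u(1)] by simp
      moreover have "nat (-i) \<in> {1, 2, 4}" using False u(3) by auto
      ultimately show ?thesis using that[OF rot_less[OF n(2)], of "nat (-i)" i u] u(2) by simp
    qed
  qed
  have removed: "(rot ?n (int 0) x, rot ?n (int j) x) \<notin> parcs ?H"
    using x(3) rot_0[OF n(2) x(1)] by auto
  \<comment> \<open>\<open>W\<close> keeps \<open>w\<close> vertices with at least \<open>q\<close>
    labels; \<open>wq\<close> is the strict ratio bound cleared of denominators. The offsets 0 and
    \<open>j\<close> are exempt because their edge is deleted.\<close>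
  have main: ?thesis
    if W: "W \<subseteq> {..<?n}" and w: "card W = w" and q: "q \<le> card (h ` W)" "1 < q"
      and wq: "(?n - w) * (k - 1) < 2 * k * q"
    and h: "\<And>i i'. i \<in> W \<Longrightarrow> i' \<in> W \<Longrightarrow> i < i' \<Longrightarrow> \<not> (i = 0 \<and> i' = j) \<Longrightarrow>
      i' = i + 1 \<or> i' = i + 2 \<or> i' = i + 4 \<or> i' + 1 = i + ?n \<or> i' + 2 = i + ?n \<or> i' + 4 = i + ?n \<Longrightarrow>
      h i = h i'"
    for W w q and h :: "nat \<Rightarrow> nat"
  proof -
    have "\<exists>S (f :: nat \<Rightarrow> nat). S \<subseteq> pverts ?H \<and> card (pverts ?H - S) = ?n - card W \<and> card (f ` S) = card (h ` W)
      \<and> (\<forall>u\<in>S. \<forall>v\<in>S. (u, v) \<in> parcs ?H \<longrightarrow> f u = f v)"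
    proof (rule circ_labelling[OF n(1) _ _ H x(1) W])
      fix i i' assume "i \<in> W" "i' \<in> W" "i < i'" "(rot ?n (int i) x, rot ?n (int i') x) \<in> parcs ?H"
        "i' = i + 1 \<or> i' = i + 2 \<or> i' = i + 4 \<or> i' + 1 = i + ?n \<or> i' + 2 = i + ?n \<or> i' + 4 = i + ?n"
      then show "h i = h i'" using h[of i i'] removed by blast
    qed auto
    then obtain S and f :: "nat \<Rightarrow> nat" where S: "S \<subseteq> pverts ?H"
      "card (pverts ?H - S) = ?n - card W" "card (f ` S) = card (h ` W)"
      "\<And>u v. u \<in> S \<Longrightarrow> v \<in> S \<Longrightarrow> (u, v) \<in> parcs ?H \<Longrightarrow> f u = f v"
      by blast
    have "2 * k * q \<le> 2 * k * card (h ` W)" using q(1) by simp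
    with wq have "(?n - card W) * (k - 1) < 2 * k * card (h ` W)" unfolding w by (rule less_le_trans)
    then have "real ((?n - card W) * (k - 1)) < real (2 * k * card (h ` W))"
      by (simp only: of_nat_less_iff)
    then have "real (?n - card W) * (real k - 1) < 2 * real k * card (h ` W)"
      using k by (simp add: of_nat_diff)
    then have "real (?n - card W) < 2 * real k / (real k - 1) * card (h ` W)"
      using k by (simp add: field_simps)
    then show ?thesis
      using S q n by (intro toughness_less[OF H _ nc, of S f]) auto
  qed
  consider "j = 1" | "j = 2" | "j = 4" using x(2) by auto
  then show ?thesis
  proof cases
    case 1
    \<comment> \<open>The classes are \<open>{3 * k - 3, 3 * k - 1, 0}\<close>,
      \<open>{1, 3}\<close> and the isolated offsets \<open>?B\<close>: \<open>k - 1\<close> labels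
      after \<open>2 * k - 1\<close> deletions. Only the deleted edge would join the first
      two.\<close>
    let ?A = "(\<lambda>i. 3 * i + 6) ` {..<k - 2}" and ?B = "(\<lambda>i. 3 * i + 6) ` {..<k - 3}"
    let ?W = "{0, 1, 3, 3 * k - 1} \<union> ?A"
    let ?h = "\<lambda>i::nat. if i = 3 then 1 else if 3 * k - 3 \<le> i then 0 else i"
    have card: "card ?A = k - 2" "card ?B = k - 3" by (subst card_image; auto simp: inj_on_def)+
    have w: "card ?W = k + 2" using card k by (subst card_Un_disjoint) auto
    have "{0, 1} \<union> ?B \<subseteq> ?h ` ?W" using k by (auto simp: image_iff)
    then have "card ({0, 1} \<union> ?B) \<le> card (?h ` ?W)" by (intro card_mono) auto
    moreover have "card ({0, 1} \<union> ?B) = k - 1" using card k by (subst card_Un_disjoint) auto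
    ultimately have q: "k - 1 \<le> card (?h ` ?W)" by (simp only:)
    show ?thesis
    proof (rule main[OF _ w q])
      show "?W \<subseteq> {..<?n}" using k by auto
      show "(?n - (k + 2)) * (k - 1) < 2 * k * (k - 1)"
        using k by (intro mult_strict_right_mono) auto
      fix i i' assume W: "i \<in> ?W" "i' \<in> ?W" "i < i'" and j: "\<not> (i = 0 \<and> i' = j)"
        and d: "i' = i + 1 \<or> i' = i + 2 \<or> i' = i + 4 \<or> i' + 1 = i + ?n \<or> i' + 2 = i + ?n \<or> i' + 4 = i + ?n"
      have "i = 0 \<or> i = 1 \<or> i = 3 \<or> i + 1 = 3 * k \<or> i mod 3 = 0 \<and> 6 \<le> i \<and> i + 3 \<le> 3 * k"
        "i' = 0 \<or> i' = 1 \<or> i' = 3 \<or> i' + 1 = 3 * k \<or> i' mod 3 = 0 \<and> 6 \<le> i' \<and> i' + 3 \<le> 3 * k"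
        using W by auto
      then have "i = 0 \<and> i' = 1 \<or> i = 1 \<and> i' = 3 \<or> (i = 0 \<or> 3 * k \<le> i + 3) \<and> 3 * k \<le> i' + 3"
        by (rule close_offsets_1[OF k W(3) d])
      then show "?h i = ?h i'" using 1 j k by auto
    qed (use k in simp)
  next
    case 2
    \<comment> \<open>Only \<open>3 * k - 4\<close> and \<open>3 * k - 2\<close> share a class, so
      there are \<open>k\<close> labels after \<open>2 * k\<close> deletions.\<close>
    let ?A = "(\<lambda>i. 3 * i + 2) ` {..<k - 1}"
    let ?W = "{0, 3 * k - 2} \<union> ?A"
    let ?h = "\<lambda>i::nat. if i = 3 * k - 2 then 3 * k - 4 else i"
    have card: "card ?A = k - 1" by (subst card_image; auto simp: inj_on_def)
    have w: "card ?W = k + 1" using card k by (subst card_Un_disjoint) auto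
    have "{0} \<union> ?A \<subseteq> ?h ` ?W" using k by (auto simp: image_iff)
    then have "card ({0} \<union> ?A) \<le> card (?h ` ?W)" by (intro card_mono) auto
    moreover have "card ({0} \<union> ?A) = k" using card k by (subst card_Un_disjoint) auto
    ultimately have q: "k \<le> card (?h ` ?W)" by (simp only:)
    show ?thesis
    proof (rule main[OF _ w q])
      show "?W \<subseteq> {..<?n}" using k by auto
      show "(?n - (k + 1)) * (k - 1) < 2 * k * k" using k by (simp add: mult.assoc)
      fix i i' assume W: "i \<in> ?W" "i' \<in> ?W" "i < i'" and j: "\<not> (i = 0 \<and> i' = j)"
        and d: "i' = i + 1 \<or> i' = i + 2 \<or> i' = i + 4 \<or> i' + 1 = i + ?n \<or> i' + 2 = i + ?n \<or> i' + 4 = i + ?n"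
      have mod3: "Suc (Suc (3 * a)) mod 3 = 2" for a :: nat by presburger
      have "i = 0 \<or> i + 2 = 3 * k \<or> i mod 3 = 2 \<and> i + 4 \<le> 3 * k"
        "i' = 0 \<or> i' + 2 = 3 * k \<or> i' mod 3 = 2 \<and> i' + 4 \<le> 3 * k"
        using W mod3 by auto
      then have "i = 0 \<and> i' = 2 \<or> i + 4 = 3 * k \<and> i' + 2 = 3 * k"
        by (rule close_offsets_2[OF k W(3) d])
      then show "?h i = ?h i'" using 2 j k by auto
    qed (use k in simp)
  next
    case 3
    \<comment> \<open>All offsets are isolated once the edge is gone, so the identity labels them:
      \<open>k\<close> labels after \<open>2 * k + 1\<close> deletions.\<close>
    let ?A = "(\<lambda>i. 3 * i + 4) ` {..<k - 1}"
    let ?W = "insert 0 ?A"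
    have "card ?A = k - 1" by (subst card_image; auto simp: inj_on_def)
    then have w: "card ?W = k" using k by (subst card_insert_disjoint) auto
    then have q: "k \<le> card ((\<lambda>i. i) ` ?W)" by simp
    show ?thesis
    proof (rule main[OF _ w q])
      show "?W \<subseteq> {..<?n}" using k by auto
      show "(?n - k) * (k - 1) < 2 * k * k" using k by (cases k) (auto simp: algebra_simps)
      fix i i' assume W: "i \<in> ?W" "i' \<in> ?W" "i < i'" and j: "\<not> (i = 0 \<and> i' = j)"
        and d: "i' = i + 1 \<or> i' = i + 2 \<or> i' = i + 4 \<or> i' + 1 = i + ?n \<or> i' + 2 = i + ?n \<or> i' + 4 = i + ?n"
      have "i = 0 \<or> i mod 3 = 1 \<and> 4 \<le> i \<and> i + 2 \<le> 3 * k"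
        "i' = 0 \<or> i' mod 3 = 1 \<and> 4 \<le> i' \<and> i' + 2 \<le> 3 * k"
        using W by auto
      then have "i = 0 \<and> i' = 4"
        by (rule close_offsets_4[OF k W(3) d])
      then show "i = i'" using 3 j by auto
    qed (use k in simp)
  qed
qed

theorem theorem1p7:
  fixes k :: nat
  assumes "k \<ge> 3"
  shows "\<exists>G :: nat pair_pre_digraph.
           pair_graph G \<and> card (pverts G) = 3 * k + 1 \<and> regular 6 G \<and>
           minimally_tough (2 * real k / (real k - 1)) G"
  unfolding minimally_tough_def
  using assms pair_graph_circ regular_circ toughness_circ toughness_del_edge_circ
  by (intro exI[of _ "circ (3 * k + 1)"]) auto

end
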